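(* Let $d$ be a positive integer and fix a $d$-RSK growth diagram on a Young diagram $F$. Let $p$ be a lattice point of $F$ and let $\lambda$ be the partition assigned to $p$. Then $\ell(\lambda)=\min(d,K)$, where $K$ is the length of the longest se-chain consisting of cells of $\mathrm{Rect}_p$. Moreover, let $T$ be the $d$-semistandard $w$-oscillating tableau formed by the partitions on the outer boundary of $F$ (listed from the point on the positive $x$-axis, $w$ the type sequence of the outer boundary). Then the length of the longest NE-chain in $F$ equals $\mathrm{MCW}_d(T)$.
   Context: Partitions: finite weakly decreasing sequences of positive integers, with $\lambda_i=0$ for $i>\ell(\lambda)$; a $d$-partition has $\ell(\lambda)\le d$. Interlacing: $\alpha\prec\beta$ (also $\beta\succ\alpha$) means $\beta_1\ge\alpha_1\ge\beta_2\ge\alpha_2\ge\cdots$. Young diagrams lie in the first quadrant, made of unit cells with integer corners, left-justified, row 1 adjacent to the $x$-axis; lattice points are corners of cells. For a lattice point $p=(x,y)$, $\mathrm{Rect}_p$ is the rectangular Young diagram $[0,x]\times[0,y]$. A filling assigns nonnegative integer entries to cells. A NE-chain is a sequence of cells with nonzero entries each weakly above and weakly to the right of the previous one; its length is the sum of the entries. A se-chain is a sequence of cells with nonzero entries each strictly below and strictly to the right of the previous; its length is the number of cells. The outer boundary is the lattice path of unit up/left steps from the positive $x$-axis to the positive $y$-axis; its type sequence records `$+$' for up, `$-$' for left. A $d$-RSK growth diagram on $F$: a filling plus a partition at each lattice point, with $\emptyset$ at all points on the axes, and every cell (entry $m$; bottom-left, top-left, bottom-right, top-right corners $\kappa,\mu,\nu,\rho$)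 satisfying: all four are $d$-partitions, $\mu\succ\kappa\prec\nu$, $\mu\prec\rho\succ\nu$, $m=0$ or $\kappa_d=0$, $\rho_1+\kappa_d=m+\min(\mu_d,\nu_d)+\max(\mu_1,\nu_1)$, and $\rho_i+\kappa_{i-1}=\min(\mu_{i-1},\nu_{i-1})+\max(\mu_i,\nu_i)$ for $2\le i\le d$. A $d$-semistandard $w$-oscillating tableau ($w=w_1\cdots w_r$) is a sequence of $d$-partitions $\emptyset=\lambda^{(0)},\ldots,\lambda^{(r)}=\emptyset$ with $\lambda^{(i-1)}\prec\lambda^{(i)}$ if $w_i=+$ and $\lambda^{(i-1)}\succ\lambda^{(i)}$ if $w_i=-$. For $d$-partitions with $\alpha\prec\beta$ set $\mathrm{MCW}_d(\alpha,\beta)=\mathrm{MCW}_d(\beta,\alpha)=\beta_1-\alpha_d$. The minimum cylindric width is $\mathrm{MCW}_d(T)=\max_{1\le i\le r}\mathrm{MCW}_d(\lambda^{(i-1)},\lambda^{(i)})$ (the smallest $L$ such that all consecutive relations hold with the additional inequality that the larger partition's first part minus the smaller partition's $d$-th part is at most $L$). *)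

theory Defs
  imports Main
begin

(* Cells are indexed by their top-right corner (i,j), i,j >= 1: the cell is
   [i-1,i] x [j-1,j]; i = column (x-direction), j = row (y-direction), row 1
   adjacent to the x-axis.  Lattice points are pairs (x,y) of naturals. *)

definition young_diagram :: "(nat \<times> nat) set \<Rightarrow> bool" where
  "young_diagram F \<longleftrightarrow> finite F \<and>
     (\<forall>(i,j)\<in>F. 1 \<le> i \<and> 1 \<le> j \<and>
        (\<forall>i' j'. 1 \<le> i' \<and> i' \<le> i \<and> 1 \<le> j' \<and> j' \<le> j \<longrightarrow> (i',j') \<in> F))"

definition lattice_points :: "(nat \<times> nat) set \<Rightarrow> (nat \<times> nat) set" where
  "lattice_points F = insert (0,0) {(x,y). \<exists>(i,j)\<in>F. x \<le> i \<and> y \<le> j}"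

definition rect_cells :: "nat \<times> nat \<Rightarrow> (nat \<times> nat) set" where
  "rect_cells p = {(i,j). 1 \<le> i \<and> i \<le> fst p \<and> 1 \<le> j \<and> j \<le> snd p}"

(* Partitions as lists of positive parts in weakly decreasing order;
   pt lam i = lam_i (1-based), 0 beyond the length. *)
definition pt :: "nat list \<Rightarrow> nat \<Rightarrow> nat" where
  "pt lam i = (if 1 \<le> i \<and> i \<le> length lam then lam ! (i - 1) else 0)"

definition is_partition :: "nat list \<Rightarrow> bool" where
  "is_partition lam \<longleftrightarrow> sorted_wrt (\<ge>) lam \<and> (\<forall>x\<in>set lam. 0 < x)"

definition dpart :: "nat \<Rightarrow> nat list \<Rightarrow> bool" where
  "dpart d lam \<longleftrightarrow> is_partition lam \<and> length lam \<le> d"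

definition interl :: "nat list \<Rightarrow> nat list \<Rightarrow> bool" where
  "interl a b \<longleftrightarrow> (\<forall>i\<ge>1. pt a i \<le> pt b i \<and> pt b (i+1) \<le> pt a i)"

definition growth_diagram ::
  "nat \<Rightarrow> (nat \<times> nat) set \<Rightarrow> (nat \<times> nat \<Rightarrow> nat) \<Rightarrow> (nat \<times> nat \<Rightarrow> nat list) \<Rightarrow> bool" where
  "growth_diagram d F m P \<longleftrightarrow>
     (\<forall>(x,y)\<in>lattice_points F. (x = 0 \<or> y = 0) \<longrightarrow> P (x,y) = []) \<and>
     (\<forall>(i,j)\<in>F.
        let \<kappa> = P (i-1, j-1); \<mu> = P (i-1, j); \<nu> = P (i, j-1); \<rho> = P (i, j) in
        dpart d \<kappa> \<and> dpart d \<mu> \<and> dpart d \<nu> \<and> dpart d \<rho> \<and>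
        interl \<kappa> \<mu> \<and> interl \<kappa> \<nu> \<and> interl \<mu> \<rho> \<and> interl \<nu> \<rho> \<and>
        (m (i,j) = 0 \<or> pt \<kappa> d = 0) \<and>
        pt \<rho> 1 + pt \<kappa> d = m (i,j) + min (pt \<mu> d) (pt \<nu> d) + max (pt \<mu> 1) (pt \<nu> 1) \<and>
        (\<forall>k. 2 \<le> k \<and> k \<le> d \<longrightarrow>
           pt \<rho> k + pt \<kappa> (k-1) = min (pt \<mu> (k-1)) (pt \<nu> (k-1)) + max (pt \<mu> k) (pt \<nu> k)))"

definition ne_chain :: "(nat \<times> nat) set \<Rightarrow> (nat \<times> nat \<Rightarrow> nat) \<Rightarrow> (nat \<times> nat) list \<Rightarrow> bool" where
  "ne_chain S m cs \<longleftrightarrow> distinct cs \<and> set cs \<subseteq> S \<and> (\<forall>c\<in>set cs. 0 < m c) \<and>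
     successively (\<lambda>a b. fst a \<le> fst b \<and> snd a \<le> snd b) cs"

definition se_chain :: "(nat \<times> nat) set \<Rightarrow> (nat \<times> nat \<Rightarrow> nat) \<Rightarrow> (nat \<times> nat) list \<Rightarrow> bool" where
  "se_chain S m cs \<longleftrightarrow> set cs \<subseteq> S \<and> (\<forall>c\<in>set cs. 0 < m c) \<and>
     successively (\<lambda>a b. fst a < fst b \<and> snd b < snd a) cs"

definition longest_ne :: "(nat \<times> nat) set \<Rightarrow> (nat \<times> nat \<Rightarrow> nat) \<Rightarrow> nat" where
  "longest_ne S m = Max {sum_list (map m cs) | cs. ne_chain S m cs}"

definition longest_se :: "(nat \<times> nat) set \<Rightarrow> (nat \<times> nat \<Rightarrow> nat) \<Rightarrow> nat" where
  "longest_se S m = Max {length cs | cs. se_chain S m cs}"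

definition outer_boundary :: "(nat \<times> nat) set \<Rightarrow> (nat \<times> nat) list \<Rightarrow> bool" where
  "outer_boundary F ps \<longleftrightarrow> ps \<noteq> [] \<and> snd (hd ps) = 0 \<and> fst (last ps) = 0 \<and>
     (\<forall>q\<in>set ps. q \<in> lattice_points F \<and> (fst q + 1, snd q + 1) \<notin> F) \<and>
     successively (\<lambda>p q. q = (fst p, snd p + 1) \<or> (fst q + 1 = fst p \<and> snd q = snd p)) ps"

(* type sequence: True = '+' (up step), False = '-' (left step) *)
definition type_seq :: "(nat \<times> nat) list \<Rightarrow> bool list" where
  "type_seq ps = map (\<lambda>(p,q). snd q = snd p + 1) (zip ps (tl ps))"

definition osc_tableau :: "nat \<Rightarrow> bool list \<Rightarrow> nat list list \<Rightarrow> bool" where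
  "osc_tableau d w T \<longleftrightarrow> length T = length w + 1 \<and> hd T = [] \<and> last T = [] \<and>
     (\<forall>lam\<in>set T. dpart d lam) \<and>
     (\<forall>i<length w. if w ! i then interl (T ! i) (T ! (i+1)) else interl (T ! (i+1)) (T ! i))"

definition mcw_pair :: "nat \<Rightarrow> nat list \<Rightarrow> nat list \<Rightarrow> nat" where
  "mcw_pair d a b = pt b 1 - pt a d"

(* MCW_d(T); the maximum over an empty index range is taken to be 0 *)
definition mcw :: "nat \<Rightarrow> bool list \<Rightarrow> nat list list \<Rightarrow> nat" where
  "mcw d w T = Max (insert 0 {if w ! i then mcw_pair d (T ! i) (T ! (i+1))
                              else mcw_pair d (T ! (i+1)) (T ! i) | i. i < length w})"

end

theory Submission
  imports Defs
begin

text \<open>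
  As long as the \<open>d\<close>-th part of \<open>\<kappa>\<close> and of one of \<open>\<mu>\<close>, \<open>\<nu>\<close> vanishes, the local rules are those of
  ordinary RSK: the first row is the last passage time of the filling, and each further row is the
  last passage time of the shadow (in the sense of Viennot) of the filling belonging to the previous
  row. Passing to the shadow shortens the longest se-chain by exactly one, which gives the number of
  parts; where both \<open>\<mu>\<^sub>d\<close> and \<open>\<nu>\<^sub>d\<close> are positive, \<open>\<rho>\<close> has \<open>d\<close> parts by interlacing.

  For the NE-chains give an edge between \<open>\<alpha> \<prec> \<beta>\<close> the width \<open>\<beta>\<^sub>1 - \<alpha>\<^sub>d\<close>. The rule for \<open>\<rho>\<^sub>1\<close> says that
  the maximal width of the top and right edges of a cell is its entry plus the maximal width of
  its left and bottom edges. Hence widths never exceed last passage times, they are not lost on the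
  way to the outer boundary, and at a cell with nonzero entry (where \<open>\<kappa>\<^sub>d = 0\<close>) the last passage time
  is attained.
\<close>

section \<open>Last passage times and shadows\<close>

text \<open>The largest sum of entries along an up-right path of cells ending at
  \<open>(x, y)\<close>.\<close>

fun lpp :: "(nat \<times> nat \<Rightarrow> nat) \<Rightarrow> nat \<Rightarrow> nat \<Rightarrow> nat" where
  "lpp m 0 y = 0"
| "lpp m (Suc x) 0 = 0"
| "lpp m (Suc x) (Suc y) = m (Suc x, Suc y) + max (lpp m x (Suc y)) (lpp m (Suc x) y)"

text \<open>Positive iff \<open>lpp m\<close> strictly increases along both the left and the bottom
  edge of the cell. By monotonicity the subtraction never truncates.\<close>

definition shadow :: "(nat \<times> nat \<Rightarrow> nat) \<Rightarrow> nat \<times> nat \<Rightarrow> nat" where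
  "shadow m = (\<lambda>(i, j). min (lpp m (i - 1) j) (lpp m i (j - 1)) - lpp m (i - 1) (j - 1))"

lemma lpp_0_right [simp]: "lpp m x 0 = 0"
  by (cases x) auto

lemma lpp_Suc_left: "lpp m x y \<le> lpp m (Suc x) y"
  by (cases y) auto

lemma lpp_Suc_right: "lpp m x y \<le> lpp m x (Suc y)"
  by (cases x) auto

lemma lpp_mono: "x \<le> x' \<Longrightarrow> y \<le> y' \<Longrightarrow> lpp m x y \<le> lpp m x' y'"
  by (meson le_trans lift_Suc_mono_le lpp_Suc_left lpp_Suc_right)

lemma lpp_rec:
  "1 \<le> i \<Longrightarrow> 1 \<le> j \<Longrightarrow> lpp m i j = m (i, j) + max (lpp m (i - 1) j) (lpp m i (j - 1))"
  by (cases i; cases j) auto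

text \<open>At a zero entry, an increase along the top edge forces one along the bottom edge; the
  descent must meet a nonzero entry, since there is no increase on the x-axis.\<close>

lemma lpp_horizontal_increase_source:
  assumes "lpp m i j < lpp m (Suc i) j"
  shows "\<exists>j'. 1 \<le> j' \<and> j' \<le> j \<and> 0 < m (Suc i, j')"
  using assms
proof (induction j)
  case (Suc j)
  show ?case
  proof (cases "m (Suc i, Suc j) = 0")
    case True
    with Suc.prems have "lpp m i j < lpp m (Suc i) j"
      using lpp_Suc_right[of m i j] by auto
    then show ?thesis using Suc.IH le_SucI by blast
  qed auto
qed simp

lemma lpp_vertical_increase_source:
  assumes "lpp m i j < lpp m i (Suc j)"
  shows "\<exists>i'. 1 \<le> i' \<and> i' \<le> i \<and> 0 < m (i', Suc j)"
  using assms
proof (induction i)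
  case (Suc i)
  show ?case
  proof (cases "m (Suc i, Suc j) = 0")
    case True
    with Suc.prems have "lpp m i j < lpp m i (Suc j)"
      using lpp_Suc_left[of m i j] by auto
    then show ?thesis using Suc.IH le_SucI by blast
  qed auto
qed simp

lemma lpp_pos_iff: "0 < lpp m x y \<longleftrightarrow> (\<exists>c\<in>rect_cells (x, y). 0 < m c)"
proof
  show "0 < lpp m x y \<Longrightarrow> \<exists>c\<in>rect_cells (x, y). 0 < m c"
  proof (induction m x y rule: lpp.induct)
    case (3 m x y)
    consider "0 < m (Suc x, Suc y)" | "0 < lpp m x (Suc y)" | "0 < lpp m (Suc x) y"
      using "3.prems" by (auto simp: max_def split: if_splits)
    then show ?case
    proof cases
      case 1
      then show ?thesis by (auto simp: rect_cells_def)
    next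
      case 2
      from "3.IH"(1)[OF this] show ?thesis by (fastforce simp: rect_cells_def)
    next
      case 3
      from "3.IH"(2)[OF this] show ?thesis by (fastforce simp: rect_cells_def)
    qed
  qed auto
next
  assume "\<exists>c\<in>rect_cells (x, y). 0 < m c"
  then obtain i j where ij: "1 \<le> i" "i \<le> x" "1 \<le> j" "j \<le> y" "0 < m (i, j)"
    by (auto simp: rect_cells_def)
  then have "0 < lpp m i j" by (simp add: lpp_rec)
  also have "\<dots> \<le> lpp m x y" using ij by (intro lpp_mono)
  finally show "0 < lpp m x y" .
qed

text \<open>
  Along a block without shadow, a positive increment on one side of a cell is carried over to the
  opposite side; the two increments caused by the given cells meet at the corner \<open>(a', b)\<close>.
\<close>
lemma shadow_between_cells:
  assumes "a < a'" "b' < b" "1 \<le> a" "1 \<le> b'" "0 < m (a, b)" "0 < m (a', b')"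
  shows "\<exists>i j. a < i \<and> i \<le> a' \<and> b' < j \<and> j \<le> b \<and> 0 < shadow m (i, j)"
proof (rule ccontr)
  assume "\<not> ?thesis"
  then have zero: "shadow m (i, j) = 0" if "a < i" "i \<le> a'" "b' < j" "j \<le> b" for i j
    using that by auto
  have row: "lpp m i (b - 1) < lpp m i b" if "a \<le> i" "i < a'" for i
    using that
  proof (induction i rule: dec_induct)
    case base
    then show ?case using assms by (simp add: lpp_rec[of a b])
  next
    case (step i)
    then have "lpp m i (b - 1) < lpp m i b" by simp
    moreover have "shadow m (Suc i, b) = 0" using zero step.hyps step.prems assms by simp
    \<comment> \<open>The left edge of cell \<open>(Suc i, b)\<close> increases, so zero shadow
      means that its bottom edge does not; hence the right edge increases as well.\<close>
    ultimately have "lpp m (Suc i) (b - 1) \<le> lpp m i (b - 1)" by (auto simp: shadow_def)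
    then show ?case
      using \<open>lpp m i (b - 1) < lpp m i b\<close> lpp_Suc_left[of m i b] by linarith
  qed
  have col: "lpp m (a' - 1) j < lpp m a' j" if "b' \<le> j" "j < b" for j
    using that
  proof (induction j rule: dec_induct)
    case base
    then show ?case using assms by (simp add: lpp_rec[of a' b'])
  next
    case (step j)
    then have "lpp m (a' - 1) j < lpp m a' j" by simp
    moreover have "shadow m (a', Suc j) = 0" using zero step.hyps step.prems assms by simp
    ultimately have "lpp m (a' - 1) (Suc j) \<le> lpp m (a' - 1) j" by (auto simp: shadow_def)
    then show ?case
      using \<open>lpp m (a' - 1) j < lpp m a' j\<close> lpp_Suc_right[of m a' j] by linarith
  qed
  have "0 < shadow m (a', b)"
    using row[of "a' - 1"] col[of "b - 1"] assms by (auto simp: shadow_def)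
  then show False using zero[of a' b] assms by simp
qed

text \<open>
  Dually, in a block of zero entries positive increments can be traced back towards the corner
  \<open>(a, b')\<close>, where a cell with entry zero cannot have both outgoing increments positive.
\<close>
lemma cell_between_shadows:
  assumes "a < a'" "b' < b" "1 \<le> a" "1 \<le> b'" "0 < shadow m (a, b)" "0 < shadow m (a', b')"
  shows "\<exists>i j. a \<le> i \<and> i < a' \<and> b' \<le> j \<and> j < b \<and> 0 < m (i, j)"
proof (rule ccontr)
  assume "\<not> ?thesis"
  then have zero: "m (i, j) = 0" if "a \<le> i" "i < a'" "b' \<le> j" "j < b" for i j
    using that by auto
  have col: "lpp m (a - 1) j < lpp m a j" if "j \<le> b - 1" "b' \<le> j" for j
    using that
  proof (induction j rule: inc_induct)
    case base
    then show ?case using assms(5) by (auto simp: shadow_def)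
  next
    case (step j)
    then have "lpp m (a - 1) (Suc j) < lpp m a (Suc j)" by simp
    moreover have "m (a, Suc j) = 0" using zero step.hyps step.prems assms by simp
    \<comment> \<open>With a zero entry, an increase along the top edge puts the maximum of the
      recursion at the bottom-right corner, so the bottom edge increases too.\<close>
    ultimately show ?case
      using lpp_rec[of a "Suc j" m] lpp_Suc_right[of m "a - 1" j] assms by auto
  qed
  have row: "lpp m i (b' - 1) < lpp m i b'" if "i \<le> a' - 1" "a \<le> i" for i
    using that
  proof (induction i rule: inc_induct)
    case base
    then show ?case using assms(6) by (auto simp: shadow_def)
  next
    case (step i)
    then have "lpp m (Suc i) (b' - 1) < lpp m (Suc i) b'" by simp
    moreover have "m (Suc i, b') = 0" using zero step.hyps step.prems assms by simp
    ultimately show ?case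
      using lpp_rec[of "Suc i" b' m] lpp_Suc_left[of m i "b' - 1"] assms by auto
  qed
  have "m (a, b') = 0" using zero assms by simp
  moreover have "lpp m a (b' - 1) < lpp m a b'" "lpp m (a - 1) b' < lpp m a b'"
    using row[of a] col[of b'] assms by auto
  ultimately show False
    using lpp_rec[of a b' m] assms by auto
qed

section \<open>Chains\<close>

lemma se_chain_Cons:
  "se_chain S m (c # cs) \<longleftrightarrow> c \<in> S \<and> 0 < m c \<and> se_chain S m cs \<and>
     (cs \<noteq> [] \<longrightarrow> fst c < fst (hd cs) \<and> snd (hd cs) < snd c)"
  by (cases cs) (auto simp: se_chain_def)

lemma se_chain_Nil [simp]: "se_chain S m []"
  by (simp add: se_chain_def)

text \<open>A shadow cell is found between each two consecutive cells. The bounds on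
  \<open>hd ds\<close> allow the next shadow cell to be put in front.\<close>

lemma se_chain_shadow:
  assumes "se_chain (rect_cells p) m (c # cs)"
  shows "\<exists>ds. se_chain (rect_cells p) (shadow m) ds \<and> length ds = length cs \<and>
           (ds \<noteq> [] \<longrightarrow> fst c < fst (hd ds) \<and> snd (hd ds) \<le> snd c)"
  using assms
proof (induction cs arbitrary: c)
  case Nil
  then show ?case by (intro exI[of _ "[]"]) simp
next
  case (Cons c2 cs)
  obtain a b where c: "c = (a, b)" by force
  obtain a' b' where c2: "c2 = (a', b')" by force
  from Cons.prems have prems: "se_chain (rect_cells p) m (c2 # cs)" "a < a'" "b' < b"
    "c \<in> rect_cells p" "c2 \<in> rect_cells p" "0 < m c" "0 < m c2"
    by (auto simp: se_chain_Cons c c2)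
  obtain ds where ds: "se_chain (rect_cells p) (shadow m) ds" "length ds = length cs"
    "ds \<noteq> [] \<longrightarrow> a' < fst (hd ds) \<and> snd (hd ds) \<le> b'"
    using Cons.IH[OF prems(1)] by (auto simp: c2)
  obtain i j where ij: "a < i" "i \<le> a'" "b' < j" "j \<le> b" "0 < shadow m (i, j)"
    using shadow_between_cells[of a a' b' b m] prems by (auto simp: c c2 rect_cells_def)
  have "(i, j) \<in> rect_cells p" using prems ij by (auto simp: c c2 rect_cells_def)
  then have "se_chain (rect_cells p) (shadow m) ((i, j) # ds)"
    using ds ij by (auto simp: se_chain_Cons)
  then show ?case using ds ij by (intro exI[of _ "(i, j) # ds"]) (auto simp: c)
qed

text \<open>A nonzero entry lies between each two consecutive shadow cells and one more below the
  last of them, so no length is lost.\<close>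

lemma se_chain_of_shadow:
  assumes "se_chain (rect_cells p) (shadow m) (c # cs)"
  shows "\<exists>ds. se_chain (rect_cells p) m ds \<and> length ds = length (c # cs) \<and>
           fst c \<le> fst (hd ds) \<and> snd (hd ds) < snd c"
  using assms
proof (induction cs arbitrary: c)
  case Nil
  obtain a b where c: "c = (a, b)" by force
  have *: "c \<in> rect_cells p" "0 < shadow m c" using Nil by (auto simp: se_chain_Cons)
  then have "lpp m (a - 1) (b - 1) < lpp m (Suc (a - 1)) (b - 1)"
    by (auto simp: c shadow_def rect_cells_def)
  from lpp_horizontal_increase_source[OF this] obtain j
    where "1 \<le> j" "j \<le> b - 1" "0 < m (a, j)" using * by (auto simp: c rect_cells_def)
  then show ?case using *
    by (intro exI[of _ "[(a, j)]"]) (auto simp: c se_chain_Cons rect_cells_def)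
next
  case (Cons c2 cs)
  obtain a b where c: "c = (a, b)" by force
  obtain a' b' where c2: "c2 = (a', b')" by force
  from Cons.prems have prems: "se_chain (rect_cells p) (shadow m) (c2 # cs)" "a < a'" "b' < b"
    "c \<in> rect_cells p" "c2 \<in> rect_cells p" "0 < shadow m c" "0 < shadow m c2"
    by (auto simp: se_chain_Cons c c2)
  obtain ds where ds: "se_chain (rect_cells p) m ds" "length ds = length (c2 # cs)"
    "a' \<le> fst (hd ds)" "snd (hd ds) < b'"
    using Cons.IH[OF prems(1)] by (auto simp: c2)
  obtain i j where ij: "a \<le> i" "i < a'" "b' \<le> j" "j < b" "0 < m (i, j)"
    using cell_between_shadows[of a a' b' b m] prems by (auto simp: c c2 rect_cells_def)
  have "(i, j) \<in> rect_cells p" using prems ij by (auto simp: c c2 rect_cells_def)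
  then have "se_chain (rect_cells p) m ((i, j) # ds)"
    using ds ij by (auto simp: se_chain_Cons)
  then show ?case using ds ij by (intro exI[of _ "(i, j) # ds"]) (auto simp: c)
qed

definition has_se_chain :: "nat \<times> nat \<Rightarrow> (nat \<times> nat \<Rightarrow> nat) \<Rightarrow> nat \<Rightarrow> bool" where
  "has_se_chain p m k \<longleftrightarrow> (\<exists>cs. se_chain (rect_cells p) m cs \<and> length cs = k)"

text \<open>Length one is excluded: the empty chain of the shadow exists even for a zero
  filling.\<close>

lemma has_se_chain_shadow:
  "has_se_chain p m (Suc (Suc k)) \<longleftrightarrow> has_se_chain p (shadow m) (Suc k)"
proof
  assume "has_se_chain p m (Suc (Suc k))"
  then obtain c cs where "se_chain (rect_cells p) m (c # cs)" "length cs = Suc k"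
    by (auto simp: has_se_chain_def length_Suc_conv)
  then show "has_se_chain p (shadow m) (Suc k)"
    using se_chain_shadow unfolding has_se_chain_def by metis
next
  assume "has_se_chain p (shadow m) (Suc k)"
  then obtain c cs where ch: "se_chain (rect_cells p) (shadow m) (c # cs)" "length cs = k"
    by (auto simp: has_se_chain_def length_Suc_conv)
  obtain ds where ds: "se_chain (rect_cells p) m ds" "length ds = Suc k"
    "fst c \<le> fst (hd ds)" "snd (hd ds) < snd c"
    using se_chain_of_shadow[OF ch(1)] ch(2) by auto
  obtain a b where c: "c = (a, b)" by force
  have *: "c \<in> rect_cells p" "0 < shadow m c" using ch by (auto simp: se_chain_Cons)
  \<comment> \<open>The left edge of the first shadow cell increases, which yields a nonzero entry
    to its left in row \<open>b\<close>, hence to the upper left of \<open>hd ds\<close>.\<close>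
  then have "lpp m (a - 1) (b - 1) < lpp m (a - 1) (Suc (b - 1))"
    by (auto simp: c shadow_def rect_cells_def)
  from lpp_vertical_increase_source[OF this] obtain i
    where i: "1 \<le> i" "i \<le> a - 1" "0 < m (i, b)" using * by (auto simp: c rect_cells_def)
  then have "se_chain (rect_cells p) m ((i, b) # ds)"
    using * ds by (auto simp: c se_chain_Cons rect_cells_def)
  then show "has_se_chain p m (Suc (Suc k))"
    using ds unfolding has_se_chain_def by (metis length_Cons)
qed

text \<open>Each passage to the shadow shortens the chain by one, down to a single cell, which
  exists iff the last passage time is positive.\<close>

lemma has_se_chain_Suc_iff:
  "has_se_chain (x, y) m (Suc n) \<longleftrightarrow> 0 < lpp ((shadow ^^ n) m) x y"
proof (induction n arbitrary: m)
  case 0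
  show ?case
  proof
    assume "has_se_chain (x, y) m (Suc 0)"
    then show "0 < lpp ((shadow ^^ 0) m) x y"
      by (auto simp: has_se_chain_def lpp_pos_iff length_Suc_conv se_chain_Cons)
  next
    assume "0 < lpp ((shadow ^^ 0) m) x y"
    then obtain c where "c \<in> rect_cells (x, y)" "0 < m c" by (auto simp: lpp_pos_iff)
    then have "se_chain (rect_cells (x, y)) m [c]" by (simp add: se_chain_Cons)
    then show "has_se_chain (x, y) m (Suc 0)" unfolding has_se_chain_def by force
  qed
next
  case (Suc n)
  then show ?case
    by (simp add: has_se_chain_shadow funpow_swap1)
qed

lemma finite_rect_cells: "finite (rect_cells p)"
proof (rule finite_subset)
  show "rect_cells p \<subseteq> {..fst p} \<times> {..snd p}" by (auto simp: rect_cells_def)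
qed simp

lemma se_chain_distinct: "se_chain S m cs \<Longrightarrow> distinct cs"
proof -
  assume "se_chain S m cs"
  then have "successively (\<lambda>a b. fst a < fst b) cs"
    unfolding se_chain_def by (auto elim: successively_mono)
  then have "sorted_wrt (\<lambda>a b. fst a < fst b) cs"
    by (subst (asm) successively_iff_sorted_wrt_strong) auto
  then have "sorted_wrt (<) (map fst cs)" by (simp add: sorted_wrt_map)
  then show ?thesis by (simp add: strict_sorted_iff distinct_map)
qed

text \<open>Prefixes of se-chains are se-chains, so exact lengths suffice; distinctness bounds the
  lengths by the number of cells.\<close>

lemma longest_se_ge_iff:
  "Suc n \<le> longest_se (rect_cells p) m \<longleftrightarrow> has_se_chain p m (Suc n)"
proof -
  let ?L = "{length cs | cs. se_chain (rect_cells p) m cs}"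
  have "?L \<subseteq> {..card (rect_cells p)}"
  proof
    fix n assume "n \<in> ?L"
    then obtain cs where cs: "se_chain (rect_cells p) m cs" "n = length cs" by auto
    then show "n \<in> {..card (rect_cells p)}"
      using card_mono[OF finite_rect_cells, of "set cs" p] distinct_card[OF se_chain_distinct]
      by (auto simp: se_chain_def)
  qed
  then have fin: "finite ?L" using finite_subset by blast
  have "?L \<noteq> {}" using se_chain_Nil by blast
  with fin have "Suc n \<le> longest_se (rect_cells p) m \<longleftrightarrow> (\<exists>k\<in>?L. Suc n \<le> k)"
    unfolding longest_se_def by (rule Max_ge_iff)
  also have "\<dots> \<longleftrightarrow> has_se_chain p m (Suc n)"
  proof
    assume "\<exists>k\<in>?L. Suc n \<le> k"
    then obtain cs where cs: "se_chain (rect_cells p) m cs" "Suc n \<le> length cs" by auto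
    have "se_chain (rect_cells p) m (take (Suc n) cs)"
      using cs(1) set_take_subset[of "Suc n" cs] successively_append_iff[of _ "take (Suc n) cs" "drop (Suc n) cs"]
      by (auto simp: se_chain_def)
    then show "has_se_chain p m (Suc n)"
      using cs by (auto simp: has_se_chain_def intro!: exI[of _ "take (Suc n) cs"])
  qed (auto simp: has_se_chain_def)
  finally show ?thesis .
qed

section \<open>NE-chains and last passage times\<close>

text \<open>By distinctness the predecessor of \<open>c\<close> lies strictly left of it or strictly
  below it, hence in one of the two rectangles of the recursion.\<close>

lemma ne_chain_sum_le_lpp:
  assumes "ne_chain S m (cs @ [c])" "\<forall>c\<in>S. 1 \<le> fst c \<and> 1 \<le> snd c"
  shows "sum_list (map m (cs @ [c])) \<le> lpp m (fst c) (snd c)"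
  using assms(1)
proof (induction cs arbitrary: c rule: rev_induct)
  case Nil
  then show ?case using assms(2) by (auto simp: ne_chain_def lpp_rec)
next
  case (snoc b cs)
  have ne: "ne_chain S m (cs @ [b])" "b \<noteq> c" "fst b \<le> fst c" "snd b \<le> snd c" "c \<in> S"
    using snoc.prems by (auto simp: ne_chain_def successively_append_iff)
  have "fst b \<le> fst c - 1 \<or> snd b \<le> snd c - 1"
    using ne by (cases b; cases c) auto
  then have "lpp m (fst b) (snd b) \<le> max (lpp m (fst c - 1) (snd c)) (lpp m (fst c) (snd c - 1))"
  proof
    assume "fst b \<le> fst c - 1"
    then show ?thesis using lpp_mono[of "fst b" "fst c - 1" "snd b" "snd c" m] ne(4) by simp
  next
    assume "snd b \<le> snd c - 1"
    then show ?thesis using lpp_mono[of "fst b" "fst c" "snd b" "snd c - 1" m] ne(3) by simp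
  qed
  then show ?case
    using snoc.IH[OF ne(1)] lpp_rec[of "fst c" "snd c" m] bspec[OF assms(2) ne(5)] by simp
qed

lemma ne_chain_mono: "ne_chain S m cs \<Longrightarrow> S \<subseteq> S' \<Longrightarrow> ne_chain S' m cs"
  by (auto simp: ne_chain_def)

lemma rect_cells_mono: "x \<le> x' \<Longrightarrow> y \<le> y' \<Longrightarrow> rect_cells (x, y) \<subseteq> rect_cells (x', y')"
  by (auto simp: rect_cells_def)

lemma ne_chain_attains_lpp:
  "\<exists>cs. ne_chain (rect_cells (x, y)) m cs \<and> sum_list (map m cs) = lpp m x y"
proof (induction m x y rule: lpp.induct)
  case (3 m x y)
  \<comment> \<open>\<open>S\<close> is the smaller rectangle of the larger branch; it omits the
    corner, so appending the corner keeps the chain distinct.\<close>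
  have "\<exists>cs S. ne_chain S m cs \<and> S \<subseteq> rect_cells (Suc x, Suc y) \<and> (Suc x, Suc y) \<notin> S \<and>
      sum_list (map m cs) = max (lpp m x (Suc y)) (lpp m (Suc x) y)"
  proof (cases "lpp m x (Suc y) \<le> lpp m (Suc x) y")
    case True
    have "(Suc x, Suc y) \<notin> rect_cells (Suc x, y)" by (simp add: rect_cells_def)
    with True "3.IH"(2) rect_cells_mono[of "Suc x" "Suc x" y "Suc y"] show ?thesis
      by (metis le_refl le_SucI max.absorb2)
  next
    case False
    have "(Suc x, Suc y) \<notin> rect_cells (x, Suc y)" by (simp add: rect_cells_def)
    with False "3.IH"(1) rect_cells_mono[of x "Suc x" "Suc y" "Suc y"] show ?thesis
      by (metis le_refl le_SucI max.absorb1 nle_le)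
  qed
  then obtain cs S where cs: "ne_chain S m cs" "S \<subseteq> rect_cells (Suc x, Suc y)"
    "(Suc x, Suc y) \<notin> S" "sum_list (map m cs) = max (lpp m x (Suc y)) (lpp m (Suc x) y)"
    by blast
  show ?case
  proof (cases "m (Suc x, Suc y) = 0")
    case True
    then show ?thesis using cs ne_chain_mono by (intro exI[of _ cs]) auto
  next
    case False
    have "last cs \<in> rect_cells (Suc x, Suc y)" if "cs \<noteq> []"
      using that cs last_in_set[of cs] unfolding ne_chain_def by blast
    then have "ne_chain (rect_cells (Suc x, Suc y)) m (cs @ [(Suc x, Suc y)])"
      using False cs by (auto simp: ne_chain_def successively_append_iff rect_cells_def)
    then show ?thesis using cs by (intro exI[of _ "cs @ [(Suc x, Suc y)]"]) auto
  qed
qed (auto simp: ne_chain_def intro!: exI[of _ "[]"])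

section \<open>Growth diagrams\<close>

lemma pt_Nil [simp]: "pt [] k = 0"
  by (simp add: pt_def)

lemma pt_pos_iff: "is_partition lam \<Longrightarrow> 1 \<le> k \<Longrightarrow> 0 < pt lam k \<longleftrightarrow> k \<le> length lam"
  by (auto simp: pt_def is_partition_def)

lemma has_se_chain_mono:
  assumes "has_se_chain (x, y) m k" "x \<le> x'" "y \<le> y'" "1 \<le> k'" "k' \<le> k"
  shows "has_se_chain (x', y') m k'"
proof -
  have "has_se_chain (x', y') m k"
    using assms(1) rect_cells_mono[OF assms(2,3)]
    unfolding has_se_chain_def se_chain_def by blast
  then show ?thesis
    using longest_se_ge_iff[of "k - 1" "(x', y')" m] longest_se_ge_iff[of "k' - 1" "(x', y')" m]
      assms(4,5) by simp
qed

locale rsk_growth =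
  fixes d :: nat and F :: "(nat \<times> nat) set" and m :: "nat \<times> nat \<Rightarrow> nat"
    and P :: "nat \<times> nat \<Rightarrow> nat list"
  assumes d_pos: "1 \<le> d" and young: "young_diagram F" and growth: "growth_diagram d F m P"
begin

lemma finite_F: "finite F"
  using young by (simp add: young_diagram_def)

lemma F_pos: "(i, j) \<in> F \<Longrightarrow> 1 \<le> i \<and> 1 \<le> j"
  using young by (auto simp: young_diagram_def)

lemma F_down: "(i, j) \<in> F \<Longrightarrow> 1 \<le> i' \<Longrightarrow> i' \<le> i \<Longrightarrow> 1 \<le> j' \<Longrightarrow> j' \<le> j \<Longrightarrow> (i', j') \<in> F"
  using young unfolding young_diagram_def by blast

lemma lattice_of_F: "(i, j) \<in> F \<Longrightarrow> x \<le> i \<Longrightarrow> y \<le> j \<Longrightarrow> (x, y) \<in> lattice_points F"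
  by (auto simp: lattice_points_def)

lemma F_of_lattice:
  assumes "(x, y) \<in> lattice_points F" "1 \<le> x" "1 \<le> y"
  shows "(x, y) \<in> F"
proof -
  obtain i j where "(i, j) \<in> F" "x \<le> i" "y \<le> j"
    using assms by (auto simp: lattice_points_def)
  then show ?thesis using F_down assms by blast
qed

lemma lattice_down:
  assumes "(x, y) \<in> lattice_points F" "x' \<le> x" "y' \<le> y"
  shows "(x', y') \<in> lattice_points F"
  using assms by (fastforce simp: lattice_points_def)

lemma rect_cells_subset_F:
  assumes "(x, y) \<in> lattice_points F"
  shows "rect_cells (x, y) \<subseteq> F"
proof
  fix c assume c: "c \<in> rect_cells (x, y)"
  then have "(x, y) \<in> F" using F_of_lattice[OF assms] by (auto simp: rect_cells_def)
  then show "c \<in> F" using c F_down by (auto simp: rect_cells_def)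
qed

lemma P_axis: "(x, y) \<in> lattice_points F \<Longrightarrow> x = 0 \<or> y = 0 \<Longrightarrow> P (x, y) = []"
  using growth unfolding growth_diagram_def by blast

lemma cell_rules:
  assumes "(i, j) \<in> F"
  shows "dpart d (P (i, j))"
    "interl (P (i - 1, j - 1)) (P (i - 1, j))" "interl (P (i - 1, j - 1)) (P (i, j - 1))"
    "interl (P (i - 1, j)) (P (i, j))" "interl (P (i, j - 1)) (P (i, j))"
    "m (i, j) = 0 \<or> pt (P (i - 1, j - 1)) d = 0"
    "pt (P (i, j)) 1 + pt (P (i - 1, j - 1)) d =
       m (i, j) + min (pt (P (i - 1, j)) d) (pt (P (i, j - 1)) d)
       + max (pt (P (i - 1, j)) 1) (pt (P (i, j - 1)) 1)"
    "2 \<le> k \<Longrightarrow> k \<le> d \<Longrightarrow> pt (P (i, j)) k + pt (P (i - 1, j - 1)) (k - 1) =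
       min (pt (P (i - 1, j)) (k - 1)) (pt (P (i, j - 1)) (k - 1))
       + max (pt (P (i - 1, j)) k) (pt (P (i, j - 1)) k)"
proof -
  note rules = bspec[OF conjunct2[OF growth[unfolded growth_diagram_def Let_def]] assms,
      unfolded prod.case]
  show "dpart d (P (i, j))"
    "interl (P (i - 1, j - 1)) (P (i - 1, j))" "interl (P (i - 1, j - 1)) (P (i, j - 1))"
    "interl (P (i - 1, j)) (P (i, j))" "interl (P (i, j - 1)) (P (i, j))"
    "m (i, j) = 0 \<or> pt (P (i - 1, j - 1)) d = 0"
    "pt (P (i, j)) 1 + pt (P (i - 1, j - 1)) d =
       m (i, j) + min (pt (P (i - 1, j)) d) (pt (P (i, j - 1)) d)
       + max (pt (P (i - 1, j)) 1) (pt (P (i, j - 1)) 1)"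
    using rules by simp_all
  show "pt (P (i, j)) k + pt (P (i - 1, j - 1)) (k - 1) =
       min (pt (P (i - 1, j)) (k - 1)) (pt (P (i, j - 1)) (k - 1))
       + max (pt (P (i - 1, j)) k) (pt (P (i, j - 1)) k)" if "2 \<le> k" "k \<le> d"
    using rules that by simp
qed

lemma dpart_P:
  assumes "(x, y) \<in> lattice_points F"
  shows "dpart d (P (x, y))"
proof (cases "x = 0 \<or> y = 0")
  case True
  then show ?thesis using P_axis[OF assms] by (simp add: dpart_def is_partition_def)
next
  case False
  then show ?thesis using cell_rules(1) F_of_lattice[OF assms] by simp
qed

lemma interl_vertical:
  assumes "(x, Suc y) \<in> lattice_points F"
  shows "interl (P (x, y)) (P (x, Suc y))"
proof (cases "x = 0")
  case True
  then show ?thesis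
    using P_axis[OF assms] P_axis[OF lattice_down[OF assms, of x y]] by (simp add: interl_def)
next
  case False
  then show ?thesis using cell_rules(5)[OF F_of_lattice[OF assms]] by simp
qed

lemma interl_horizontal:
  assumes "(Suc x, y) \<in> lattice_points F"
  shows "interl (P (x, y)) (P (Suc x, y))"
proof (cases "y = 0")
  case True
  then show ?thesis
    using P_axis[OF assms] P_axis[OF lattice_down[OF assms, of x y]] by (simp add: interl_def)
next
  case False
  then show ?thesis using cell_rules(4)[OF F_of_lattice[OF assms]] by simp
qed

lemma interl_pt_le: "interl a b \<Longrightarrow> 1 \<le> k \<Longrightarrow> pt a k \<le> pt b k"
  by (simp add: interl_def)

section \<open>Thin points and the number of parts\<close>

text \<open>Off the axes this says \<open>min \<mu>\<^sub>d \<nu>\<^sub>d = 0\<close> for the cell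
  with top-right corner \<open>(x, y)\<close>. Testing the neighbours includes points where the
  \<open>d\<close>-th part first becomes positive.\<close>

definition thin :: "nat \<Rightarrow> nat \<Rightarrow> bool" where
  "thin x y \<longleftrightarrow> x = 0 \<or> y = 0 \<or> pt (P (x - 1, y)) d = 0 \<or> pt (P (x, y - 1)) d = 0"

lemma thin_of_zero:
  assumes "(x, y) \<in> lattice_points F" "pt (P (x, y)) d = 0"
  shows "thin x y"
proof (cases x)
  case (Suc x')
  then show ?thesis
    using interl_pt_le[OF interl_horizontal d_pos, of x' y] assms by (simp add: thin_def)
qed (simp add: thin_def)

text \<open>
  At thin points the term \<open>min \<mu>\<^sub>d \<nu>\<^sub>d - \<kappa>\<^sub>d\<close> that is fed back into the first row vanishes everywhere
  south-west of the point, so the rules are those of ordinary RSK there: row \<open>k + 1\<close> evolves like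
  the first row for the filling \<open>min \<mu>\<^sub>k \<nu>\<^sub>k - \<kappa>\<^sub>k\<close>, the shadow of the filling of row \<open>k\<close>.
\<close>
lemma thin_parts:
  assumes "(x, y) \<in> lattice_points F" "thin x y" "1 \<le> k" "k \<le> d"
  shows "pt (P (x, y)) k = lpp ((shadow ^^ (k - 1)) m) x y"
  using assms
proof (induction "x + y" arbitrary: x y k rule: less_induct)
  case less
  show ?case
  proof (cases "x = 0 \<or> y = 0")
    case True
    then show ?thesis using P_axis[OF less.prems(1)] by auto
  next
    case False
    then have F: "(x, y) \<in> F" using F_of_lattice less.prems(1) by simp
    note r = cell_rules[OF F]
    note lat = lattice_of_F[OF F]
    have zero: "pt (P (x - 1, y - 1)) d = 0"
      "min (pt (P (x - 1, y)) d) (pt (P (x, y - 1)) d) = 0"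
      using less.prems(2) False interl_pt_le[OF r(2) d_pos] interl_pt_le[OF r(3) d_pos]
      by (auto simp: thin_def)
    \<comment> \<open>The bottom-left corner is the lower neighbour of the top-left one and the left
      neighbour of the bottom-right one, so its zero \<open>d\<close>-th part makes both
      thin.\<close>
    have thin: "thin (x - 1) (y - 1)" "thin (x - 1) y" "thin x (y - 1)"
      using thin_of_zero[OF lat zero(1)] zero(1) by (auto simp: thin_def)
    have IH: "pt (P (x - 1, y - 1)) l = lpp ((shadow ^^ (l - 1)) m) (x - 1) (y - 1)"
      "pt (P (x - 1, y)) l = lpp ((shadow ^^ (l - 1)) m) (x - 1) y"
      "pt (P (x, y - 1)) l = lpp ((shadow ^^ (l - 1)) m) x (y - 1)" if "1 \<le> l" "l \<le> d" for l
      using that False less.hyps[OF _ lat thin(1) that] less.hyps[OF _ lat thin(2) that]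
        less.hyps[OF _ lat thin(3) that] by simp_all
    have rec: "lpp ((shadow ^^ (k - 1)) m) x y = (shadow ^^ (k - 1)) m (x, y)
        + max (pt (P (x - 1, y)) k) (pt (P (x, y - 1)) k)"
      using False IH[OF less.prems(3,4)] by (simp add: lpp_rec)
    show ?thesis
    proof (cases "k = 1")
      case True
      then show ?thesis using r(7) zero rec by simp
    next
      case False
      then have k: "1 \<le> k - 1" "k - 1 \<le> d" "2 \<le> k" "k - 1 = Suc (k - 1 - 1)"
        using less.prems by auto
      have "(shadow ^^ (k - 1)) m (x, y) =
          min (pt (P (x - 1, y)) (k - 1)) (pt (P (x, y - 1)) (k - 1)) - pt (P (x - 1, y - 1)) (k - 1)"
        by (subst k(4)) (simp only: funpow.simps o_apply shadow_def prod.case IH[OF k(1,2)])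
      \<comment> \<open>Interlacing keeps the subtraction in the shadow exact.\<close>
      moreover have "pt (P (x - 1, y - 1)) (k - 1)
          \<le> min (pt (P (x - 1, y)) (k - 1)) (pt (P (x, y - 1)) (k - 1))"
        using interl_pt_le[OF r(2) k(1)] interl_pt_le[OF r(3) k(1)] by simp
      moreover have "r = l" if "s = a - c" "c \<le> a" "r + c = a + b" "l = s + b"
        for r l s a b c :: nat using that by simp
      ultimately show ?thesis using r(8)[OF k(3) less.prems(4)] rec by blast
    qed
  qed
qed

text \<open>At a point that is not thin, the left neighbour has \<open>d\<close> positive parts and
  so, by induction, a chain of length \<open>d\<close>; both sides then hold.\<close>

lemma part_pos_iff_se_chain:
  assumes "(x, y) \<in> lattice_points F" "1 \<le> k" "k \<le> d"
  shows "0 < pt (P (x, y)) k \<longleftrightarrow> has_se_chain (x, y) m k"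
  using assms
proof (induction x arbitrary: k)
  case 0
  then show ?case
    using P_axis[of 0 y] has_se_chain_Suc_iff[of 0 y m "k - 1"] by simp
next
  case (Suc x)
  show ?case
  proof (cases "thin (Suc x) y")
    case True
    then show ?thesis
      using Suc.prems thin_parts has_se_chain_Suc_iff[of "Suc x" y m "k - 1"] by simp
  next
    case False
    then have pos: "0 < pt (P (x, y)) d" by (auto simp: thin_def)
    have lat: "(x, y) \<in> lattice_points F" using lattice_down[OF Suc.prems(1)] by simp
    have "has_se_chain (x, y) m d" using Suc.IH[OF lat d_pos] pos by simp
    then have "has_se_chain (Suc x, y) m k" using has_se_chain_mono Suc.prems by simp
    moreover have "0 < pt (P (Suc x, y)) d"
      using pos interl_pt_le[OF interl_horizontal[OF Suc.prems(1)] d_pos] by simp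
    then have "0 < pt (P (Suc x, y)) k"
      using pt_pos_iff[of "P (Suc x, y)"] dpart_P[OF Suc.prems(1)] d_pos Suc.prems(2,3)
      by (simp add: dpart_def)
    ultimately show ?thesis by simp
  qed
qed

theorem length_P:
  assumes "p \<in> lattice_points F"
  shows "length (P p) = min d (longest_se (rect_cells p) m)"
proof -
  obtain x y where p: "p = (x, y)" by force
  have part: "is_partition (P p)" "length (P p) \<le> d"
    using dpart_P assms by (auto simp: p dpart_def)
  have iff: "k \<le> length (P p) \<longleftrightarrow> k \<le> longest_se (rect_cells p) m" if "k \<le> d" for k
  proof (cases k)
    case (Suc n)
    then show ?thesis
      using that assms part_pos_iff_se_chain[of x y k] pt_pos_iff[OF part(1), of k]
        longest_se_ge_iff[of n p m] by (simp add: p)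
  qed simp
  show ?thesis
    using iff[of "length (P p)"] iff[of "min d (longest_se (rect_cells p) m)"] part(2) by simp
qed

section \<open>Cylindric widths of the edges\<close>

text \<open>By interlacing, the larger partition is at the right end of a horizontal edge and at the
  upper end of a vertical one.\<close>

definition hwidth :: "nat \<Rightarrow> nat \<Rightarrow> nat" where
  "hwidth x y = mcw_pair d (P (x, y)) (P (Suc x, y))"

definition vwidth :: "nat \<Rightarrow> nat \<Rightarrow> nat" where
  "vwidth x y = mcw_pair d (P (x, y)) (P (x, Suc y))"

lemma cell_width:
  assumes "(Suc x, Suc y) \<in> F"
  shows "max (hwidth x (Suc y)) (vwidth (Suc x) y) =
    m (Suc x, Suc y) + max (hwidth x y) (vwidth x y)"
proof -
  have "max (r - u) (r - v) = n + max (b - k) (a - k)"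
    if "r + k = n + min u v + max a b" "n = 0 \<or> k = 0" for r k n u v a b :: nat
  proof -
    have "max (r - u) (r - v) = r - min u v" by (cases "u \<le> v") (auto simp: max_def)
    also have "\<dots> = n + max a b - k" using that(1) by simp
    \<comment> \<open>Either \<open>n = 0\<close>, or \<open>k = 0\<close> and nothing is
      subtracted.\<close>
    also have "\<dots> = n + (max a b - k)" using that(2) by auto
    also have "max a b - k = max (b - k) (a - k)" by (cases "a \<le> b") (auto simp: max_def)
    finally show ?thesis .
  qed
  from this[OF cell_rules(7,6)[OF assms]] show ?thesis
    by (simp add: hwidth_def vwidth_def mcw_pair_def)
qed

text \<open>A nonzero entry forces \<open>\<kappa>\<^sub>d = 0\<close>, so the left and bottom edges
  have widths \<open>\<mu>\<^sub>1\<close> and \<open>\<nu>\<^sub>1\<close>. Both corners are thin,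
  so these are last passage times.\<close>

lemma cell_width_eq_lpp:
  assumes "(Suc x, Suc y) \<in> F" "0 < m (Suc x, Suc y)"
  shows "max (hwidth x (Suc y)) (vwidth (Suc x) y) = lpp m (Suc x) (Suc y)"
proof -
  have zero: "pt (P (x, y)) d = 0" using cell_rules(6)[OF assms(1)] assms(2) by simp
  then have "thin (Suc x) y" "thin x (Suc y)" by (auto simp: thin_def)
  then have "pt (P (Suc x, y)) 1 = lpp m (Suc x) y" "pt (P (x, Suc y)) 1 = lpp m x (Suc y)"
    using thin_parts[OF lattice_of_F[OF assms(1), of "Suc x" y], of 1]
      thin_parts[OF lattice_of_F[OF assms(1), of x "Suc y"], of 1] d_pos by simp_all
  then show ?thesis
    using cell_width[OF assms(1)] zero by (simp add: hwidth_def vwidth_def mcw_pair_def max.commute)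
qed

lemma hwidth_axis: "(Suc x, 0) \<in> lattice_points F \<Longrightarrow> hwidth x 0 = 0"
  using P_axis by (simp add: hwidth_def mcw_pair_def)

lemma vwidth_axis: "(0, Suc y) \<in> lattice_points F \<Longrightarrow> vwidth 0 y = 0"
  using P_axis by (simp add: vwidth_def mcw_pair_def)

text \<open>The left edge is the right edge of the cell to the left, the bottom edge is the top edge
  of the cell below, and edges on the axes have width 0.\<close>

lemma cell_width_le_lpp:
  assumes "(Suc x, Suc y) \<in> F"
  shows "max (hwidth x (Suc y)) (vwidth (Suc x) y) \<le> lpp m (Suc x) (Suc y)"
  using assms
proof (induction "x + y" arbitrary: x y rule: less_induct)
  case less
  have "hwidth x y \<le> lpp m (Suc x) y"
  proof (cases y)
    case 0
    then show ?thesis using hwidth_axis lattice_of_F[OF less.prems, of "Suc x" y] by simp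
  next
    case (Suc y')
    then have "(Suc x, Suc y') \<in> F" using F_down[OF less.prems, of "Suc x" "Suc y'"] by simp
    from less.hyps[OF _ this] show ?thesis by (simp add: Suc)
  qed
  moreover have "vwidth x y \<le> lpp m x (Suc y)"
  proof (cases x)
    case 0
    then show ?thesis using vwidth_axis lattice_of_F[OF less.prems, of x "Suc y"] by simp
  next
    case (Suc x')
    then have "(Suc x', Suc y) \<in> F" using F_down[OF less.prems, of "Suc x'" "Suc y"] by simp
    from less.hyps[OF _ this] show ?thesis by (simp add: Suc)
  qed
  ultimately show ?case using cell_width[OF less.prems]
    by (simp add: max.coboundedI1 max.coboundedI2)
qed

lemma hwidth_le_lpp:
  assumes "(Suc x, y) \<in> lattice_points F"
  shows "hwidth x y \<le> lpp m (Suc x) y"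
proof (cases y)
  case 0
  then show ?thesis using hwidth_axis assms by simp
next
  case (Suc y')
  then show ?thesis using cell_width_le_lpp[of x y'] F_of_lattice[OF assms] by simp
qed

lemma vwidth_le_lpp:
  assumes "(x, Suc y) \<in> lattice_points F"
  shows "vwidth x y \<le> lpp m x (Suc y)"
proof (cases x)
  case 0
  then show ?thesis using vwidth_axis assms by simp
next
  case (Suc x')
  then show ?thesis using cell_width_le_lpp[of x' y] F_of_lattice[OF assms] by simp
qed

text \<open>By \<open>cell_width\<close>, widths do not get lost when edges are pushed across cells.\<close>
lemma width_reaches_boundary:
  assumes "(Suc x, y) \<in> lattice_points F \<and> V \<le> hwidth x y \<or>
           (x, Suc y) \<in> lattice_points F \<and> V \<le> vwidth x y"
  shows "\<exists>x y. (Suc x, Suc y) \<notin> F \<and>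
           ((Suc x, y) \<in> lattice_points F \<and> V \<le> hwidth x y \<or>
            (x, Suc y) \<in> lattice_points F \<and> V \<le> vwidth x y)"
proof -
  \<comment> \<open>Coordinate sums of cells are at most \<open>N\<close>, so
    \<open>N - (x + y)\<close> drops whenever an edge crosses a cell.\<close>
  define N where "N = Max ((\<lambda>(i, j). i + j) ` F)"
  have N: "i + j \<le> N" if "(i, j) \<in> F" for i j
    unfolding N_def using that finite_F by (force intro: Max_ge)
  show ?thesis
    using assms
  proof (induction "N - (x + y)" arbitrary: x y rule: less_induct)
    case less
    show ?case
    proof (cases "(Suc x, Suc y) \<in> F")
      case True
      have "V \<le> max (hwidth x (Suc y)) (vwidth (Suc x) y)"
        using less.prems cell_width[OF True] by auto
      moreover have "(Suc x, Suc y) \<in> lattice_points F" using lattice_of_F[OF True] by simp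
      moreover have "N - (x + Suc y) < N - (x + y)" "N - (Suc x + y) < N - (x + y)"
        using N[OF True] by auto
      ultimately show ?thesis
        using less.hyps[of x "Suc y"] less.hyps[of "Suc x" y] by (auto simp: le_max_iff_disj)
    next
      case False
      then show ?thesis using less.prems by blast
    qed
  qed
qed

section \<open>The outer boundary\<close>

text \<open>Discrete intermediate values, used to find where the boundary path crosses a given
  column or row.\<close>

lemma switching_index:
  fixes n :: nat
  assumes "Q 0" "\<not> Q n"
  shows "\<exists>i<n. Q i \<and> \<not> Q (Suc i)"
  using assms
proof (induction n)
  case (Suc n)
  then show ?case by (metis lessI less_SucI)
qed simp

lemma length_type_seq: "length (type_seq ps) = length ps - 1"
  by (simp add: type_seq_def)

lemma nth_type_seq:
  "Suc i < length ps \<Longrightarrow> type_seq ps ! i \<longleftrightarrow> snd (ps ! Suc i) = snd (ps ! i) + 1"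
  by (simp add: type_seq_def nth_tl)

context
  fixes ps
  assumes boundary: "outer_boundary F ps"
begin

lemma boundary_point:
  "i < length ps \<Longrightarrow> ps ! i \<in> lattice_points F \<and> (Suc (fst (ps ! i)), Suc (snd (ps ! i))) \<notin> F"
  using boundary by (auto simp: outer_boundary_def)

lemma boundary_step:
  assumes "Suc i < length ps"
  shows "(\<exists>x y. ps ! i = (x, y) \<and> ps ! Suc i = (x, Suc y) \<and> type_seq ps ! i) \<or>
         (\<exists>x y. ps ! i = (Suc x, y) \<and> ps ! Suc i = (x, y) \<and> \<not> type_seq ps ! i)"
proof -
  have "ps ! Suc i = (fst (ps ! i), snd (ps ! i) + 1) \<or>
      (fst (ps ! Suc i) + 1 = fst (ps ! i) \<and> snd (ps ! Suc i) = snd (ps ! i))"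
    using boundary assms by (simp add: outer_boundary_def successively_conv_nth)
  then show ?thesis
    using nth_type_seq[OF assms] by (cases "ps ! i"; cases "ps ! Suc i") auto
qed

lemma boundary_ends:
  "ps \<noteq> []" "snd (ps ! 0) = 0" "fst (ps ! (length ps - 1)) = 0"
  using boundary by (auto simp: outer_boundary_def hd_conv_nth last_conv_nth)

text \<open>The path starts at abscissa at least \<open>Suc x\<close> and ends at 0, so some left
  step leads from \<open>Suc x\<close> to \<open>x\<close>. Its height and \<open>y\<close> are both
  the height of column \<open>Suc x\<close>.\<close>

lemma boundary_horizontal_edge:
  assumes "(Suc x, y) \<in> lattice_points F" "(Suc x, Suc y) \<notin> F"
  shows "\<exists>i. Suc i < length ps \<and> ps ! i = (Suc x, y) \<and> ps ! Suc i = (x, y)"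
proof -
  obtain a b where ab: "(a, b) \<in> F" "Suc x \<le> a"
    using assms(1) by (auto simp: lattice_points_def)
  have "(Suc (fst (ps ! 0)), 1) \<notin> F"
    using boundary_point[of 0] boundary_ends by simp
  then have "Suc x \<le> fst (ps ! 0)"
    using F_down[OF ab(1), of "Suc (fst (ps ! 0))" 1] ab F_pos[OF ab(1)] by linarith
  then obtain i where i: "i < length ps - 1" "Suc x \<le> fst (ps ! i)" "\<not> Suc x \<le> fst (ps ! Suc i)"
    using switching_index[of "\<lambda>i. Suc x \<le> fst (ps ! i)" "length ps - 1"] boundary_ends by auto
  then have "Suc i < length ps" by simp
  from boundary_step[OF this] i obtain y' where y': "ps ! i = (Suc x, y')" "ps ! Suc i = (x, y')"
    by auto
  \<comment> \<open>The missing cell comes from the left end \<open>(x, y')\<close> of the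
    step.\<close>
  have "(Suc x, y') \<in> lattice_points F" "(Suc x, Suc y') \<notin> F"
    using boundary_point[of i] boundary_point[of "Suc i"] \<open>Suc i < length ps\<close> y' by auto
  then have "\<not> y < y'" "\<not> y' < y"
    using assms F_of_lattice[of "Suc x" y] F_of_lattice[of "Suc x" y']
      F_down[of "Suc x" y' "Suc x" "Suc y"] F_down[of "Suc x" y "Suc x" "Suc y'"] by auto
  then have "y' = y" by simp
  then show ?thesis using y' \<open>Suc i < length ps\<close> by blast
qed

text \<open>The transposed argument; the missing cell comes from the lower end of the step.\<close>

lemma boundary_vertical_edge:
  assumes "(x, Suc y) \<in> lattice_points F" "(Suc x, Suc y) \<notin> F"
  shows "\<exists>i. Suc i < length ps \<and> ps ! i = (x, y) \<and> ps ! Suc i = (x, Suc y)"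
proof -
  obtain a b where ab: "(a, b) \<in> F" "Suc y \<le> b"
    using assms(1) by (auto simp: lattice_points_def)
  let ?n = "length ps - 1"
  have "(1, Suc (snd (ps ! ?n))) \<notin> F"
    using boundary_point[of ?n] boundary_ends by simp
  then have "Suc y \<le> snd (ps ! ?n)"
    using F_down[OF ab(1), of 1 "Suc (snd (ps ! ?n))"] ab F_pos[OF ab(1)] by linarith
  then obtain i where i: "i < ?n" "\<not> Suc y \<le> snd (ps ! i)" "Suc y \<le> snd (ps ! Suc i)"
    using switching_index[of "\<lambda>i. \<not> Suc y \<le> snd (ps ! i)" ?n] boundary_ends by auto
  then have "Suc i < length ps" by simp
  from boundary_step[OF this] i obtain x' where x': "ps ! i = (x', y)" "ps ! Suc i = (x', Suc y)"
    by auto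
  have "(x', Suc y) \<in> lattice_points F" "(Suc x', Suc y) \<notin> F"
    using boundary_point[of i] boundary_point[of "Suc i"] \<open>Suc i < length ps\<close> x' by auto
  then have "\<not> x < x'" "\<not> x' < x"
    using assms F_of_lattice[of x "Suc y"] F_of_lattice[of x' "Suc y"]
      F_down[of x' "Suc y" "Suc x" "Suc y"] F_down[of x "Suc y" "Suc x'" "Suc y"] by auto
  then have "x' = x" by simp
  then show ?thesis using x' \<open>Suc i < length ps\<close> by blast
qed

lemma boundary_osc_tableau: "osc_tableau d (type_seq ps) (map P ps)"
  unfolding osc_tableau_def
proof (intro conjI allI impI ballI)
  show "length (map P ps) = length (type_seq ps) + 1"
    using boundary_ends(1) by (cases ps) (auto simp: length_type_seq)
  have "P (ps ! 0) = []"
    using boundary_point[of 0] boundary_ends P_axis by (cases "ps ! 0") auto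
  then show "hd (map P ps) = []"
    using boundary_ends(1) by (simp add: hd_map hd_conv_nth)
  have "P (ps ! (length ps - 1)) = []"
    using boundary_point[of "length ps - 1"] boundary_ends P_axis
    by (cases "ps ! (length ps - 1)") auto
  then show "last (map P ps) = []"
    using boundary_ends(1) by (simp add: last_map last_conv_nth)
next
  fix lam assume "lam \<in> set (map P ps)"
  then obtain q where "q \<in> lattice_points F" "lam = P q"
    using boundary by (auto simp: outer_boundary_def)
  then show "dpart d lam" using dpart_P by (cases q) simp
next
  fix i assume "i < length (type_seq ps)"
  then have i: "Suc i < length ps" by (simp add: length_type_seq)
  then show "if type_seq ps ! i then interl (map P ps ! i) (map P ps ! (i + 1))
             else interl (map P ps ! (i + 1)) (map P ps ! i)"
    using boundary_step[OF i] boundary_point[of i] boundary_point[of "Suc i"]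
      interl_vertical interl_horizontal by auto
qed

text \<open>Boundary widths are at most last passage times, which NE-chains attain. Conversely, the
  last passage time at the final cell of a chain is the width of its top or right edge, and a
  boundary edge is at least as wide.\<close>

lemma boundary_mcw: "mcw d (type_seq ps) (map P ps) = longest_ne F m"
proof -
  let ?w = "\<lambda>i. if type_seq ps ! i then mcw_pair d (map P ps ! i) (map P ps ! (i + 1))
                else mcw_pair d (map P ps ! (i + 1)) (map P ps ! i)"
  let ?M = "insert 0 {?w i | i. i < length (type_seq ps)}"
  let ?C = "{sum_list (map m cs) | cs. ne_chain F m cs}"
  have "finite {cs. set cs \<subseteq> F \<and> distinct cs}"
    by (rule finite_subset_distinct[OF finite_F])
  then have "finite {cs. ne_chain F m cs}"
    by (rule rev_finite_subset) (auto simp: ne_chain_def)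
  then have finC: "finite ?C" by (simp add: setcompr_eq_image)
  have finM: "finite ?M" by (simp add: setcompr_eq_image)
  have nil: "ne_chain F m []" by (simp add: ne_chain_def)
  have lpp_le: "lpp m x y \<le> longest_ne F m" if xy: "(x, y) \<in> lattice_points F" for x y
  proof -
    obtain cs where "ne_chain (rect_cells (x, y)) m cs" "sum_list (map m cs) = lpp m x y"
      using ne_chain_attains_lpp by blast
    then have "lpp m x y \<in> ?C" using ne_chain_mono[OF _ rect_cells_subset_F[OF xy]] by force
    then show ?thesis unfolding longest_ne_def using finC by (rule Max_ge[rotated])
  qed
  have "?w i \<le> longest_ne F m" if "i < length (type_seq ps)" for i
  proof -
    have i: "Suc i < length ps" using that by (simp add: length_type_seq)
    from boundary_step[OF i] show ?thesis
    proof (elim disjE exE conjE)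
      fix x y assume e: "ps ! i = (x, y)" "ps ! Suc i = (x, Suc y)" "type_seq ps ! i"
      then have "(x, Suc y) \<in> lattice_points F" using boundary_point[OF i] by simp
      then have "vwidth x y \<le> longest_ne F m" using vwidth_le_lpp lpp_le le_trans by blast
      then show ?thesis using e i by (simp add: vwidth_def)
    next
      fix x y assume e: "ps ! i = (Suc x, y)" "ps ! Suc i = (x, y)" "\<not> type_seq ps ! i"
      then have "(Suc x, y) \<in> lattice_points F" using boundary_point[of i] i by simp
      then have "hwidth x y \<le> longest_ne F m" using hwidth_le_lpp lpp_le le_trans by blast
      then show ?thesis using e i by (simp add: hwidth_def)
    qed
  qed
  then have "Max ?M \<le> longest_ne F m" using finM by (intro Max.boundedI) auto
  moreover have "sum_list (map m cs) \<le> Max ?M" if cs: "ne_chain F m cs" for cs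
  \<comment> \<open>Only the last cell of the chain matters; the empty chain has sum 0.\<close>
  proof (cases cs rule: rev_cases)
    case (snoc ds c)
    then have c: "c \<in> F" "0 < m c" using cs by (auto simp: ne_chain_def)
    then obtain x y where xy: "c = (Suc x, Suc y)"
      using F_pos by (cases c) (metis Suc_le_D One_nat_def)
    let ?V = "lpp m (Suc x) (Suc y)"
    have "sum_list (map m cs) \<le> ?V"
      using ne_chain_sum_le_lpp[of F m ds c] cs F_pos unfolding snoc xy by fastforce
    also have "?V \<le> Max ?M"
    proof -
      have "(Suc x, Suc y) \<in> lattice_points F" using c xy lattice_of_F by blast
      moreover have "?V \<le> hwidth x (Suc y) \<or> ?V \<le> vwidth (Suc x) y"
        using cell_width_eq_lpp[of x y] c xy by (metis le_max_iff_disj order_refl)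
      ultimately obtain x' y' where nF: "(Suc x', Suc y') \<notin> F"
        and e: "(Suc x', y') \<in> lattice_points F \<and> ?V \<le> hwidth x' y' \<or>
            (x', Suc y') \<in> lattice_points F \<and> ?V \<le> vwidth x' y'"
        using width_reaches_boundary[of x "Suc y" ?V] width_reaches_boundary[of "Suc x" y ?V] by blast
      from e have "\<exists>i. i < length (type_seq ps) \<and> ?V \<le> ?w i"
      proof
        assume h: "(Suc x', y') \<in> lattice_points F \<and> ?V \<le> hwidth x' y'"
        then obtain i where i: "Suc i < length ps" "ps ! i = (Suc x', y')" "ps ! Suc i = (x', y')"
          using boundary_horizontal_edge nF by blast
        then have "?w i = hwidth x' y'" using nth_type_seq[of i ps] by (simp add: hwidth_def)
        then show ?thesis using h i(1) by (intro exI[of _ i]) (simp add: length_type_seq)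
      next
        assume v: "(x', Suc y') \<in> lattice_points F \<and> ?V \<le> vwidth x' y'"
        then obtain i where i: "Suc i < length ps" "ps ! i = (x', y')" "ps ! Suc i = (x', Suc y')"
          using boundary_vertical_edge nF by blast
        then have "?w i = vwidth x' y'" using nth_type_seq[of i ps] by (simp add: vwidth_def)
        then show ?thesis using v i(1) by (intro exI[of _ i]) (simp add: length_type_seq)
      qed
      then obtain i where i: "i < length (type_seq ps)" "?V \<le> ?w i" by blast
      then have "?w i \<in> ?M" by blast
      then show ?thesis using Max_ge[OF finM] i(2) le_trans by blast
    qed
    finally show ?thesis .
  qed simp
  then have "longest_ne F m \<le> Max ?M"
    unfolding longest_ne_def using finC nil by (intro Max.boundedI) blast+
  ultimately show ?thesis unfolding mcw_def by (rule antisym)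
qed

end

end

theorem theorem3p6:
  fixes d :: nat and F :: "(nat \<times> nat) set" and m :: "nat \<times> nat \<Rightarrow> nat"
    and P :: "nat \<times> nat \<Rightarrow> nat list"
  assumes "1 \<le> d" and "young_diagram F" and "growth_diagram d F m P"
  shows "(\<forall>p\<in>lattice_points F. length (P p) = min d (longest_se (rect_cells p) m)) \<and>
         (\<forall>ps. outer_boundary F ps \<longrightarrow>
            osc_tableau d (type_seq ps) (map P ps) \<and>
            longest_ne F m = mcw d (type_seq ps) (map P ps))"
proof -
  interpret rsk_growth d F m P using assms by unfold_locales
  show ?thesis using length_P boundary_osc_tableau boundary_mcw by simp
qed

end
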